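(* Let $c,d$ be constants with $c>10$. Let $G$ be a $d$-regular $c$-expander on $n$ vertices where $n$ is odd, and let $b\in\{0,1\}^n$ be the all-1s vector. Then all SubCubeSums refutations of the Tseitin contradiction corresponding to $G,b$ require combinatorial size exponential in $n$; that is, there are $\varepsilon>0$ and $n_0$, depending only on $c$ and $d$, such that for every such $G$ with $n\ge n_0$, every SubCubeSums refutation has combinatorial size at least $2^{\varepsilon n}$.
   Context: A graph $G=(V,E)$ is a $c$-expander if for all $V'\subseteq V$ with $|V'|\le|V|/2$, $|\delta(V')|\ge c|V'|$, where $\delta(V')=\{(u,v)\in E\mid u\in V',v\in V\setminus V'\}$. Tseitin contradiction for $G,b$ (with $\sum_u b_u\equiv1\bmod2$): one variable $x_e$ per edge $e$; for each vertex $u$ of degree $d_u$ a set $S_u$ of $2^{d_u-1}$ clauses of width $d_u$, one for each assignment to $\{x_e: e\ni u\}$ with parity $\ne b_u$, falsified exactly by that assignment; together they express $\sum_{e\ni u}x_e\equiv b_u\bmod 2$. For a multi-set $F$ of clauses and a total assignment $\alpha$, $\mathrm{viol}_F(\alpha)$ is the number of clauses of $F$ (with multiplicity) falsified by $\alpha$. A SubCubeSums refutation of an unsatisfiable CNF $F$ over variables $X$ is a multi-set $\mathcal{C}$ of non-tautologous clauses over $X$ with $\mathrm{viol}_F(\alpha)=1+\mathrm{viol}_{\mathcal{C}}(\alpha)$ for all $\alpha\in\{0,1\}^X$. Its combinatorial size is the number of clauses of $\mathcal{C}$ counted with multiplicity. *)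

theory Defs
  imports Complex_Main "HOL-Library.Multiset" "HOL-Library.FuncSet" "HOL-Library.Ramsey"
begin

section \<open>Graphs\<close>

text \<open>Finite simple undirected graphs; an edge is the two-element set of its endpoints.\<close>

definition simple_graph :: "'a set \<Rightarrow> 'a set set \<Rightarrow> bool" where
  "simple_graph V E \<longleftrightarrow> finite V \<and> E \<subseteq> nsets V 2"

definition incident_edges :: "'a set set \<Rightarrow> 'a \<Rightarrow> 'a set set" where
  "incident_edges E u = {e \<in> E. u \<in> e}"

definition regular_graph :: "nat \<Rightarrow> 'a set \<Rightarrow> 'a set set \<Rightarrow> bool" where
  "regular_graph d V E \<longleftrightarrow> (\<forall>u\<in>V. card (incident_edges E u) = d)"

definition edge_boundary :: "'a set \<Rightarrow> 'a set set \<Rightarrow> 'a set \<Rightarrow> 'a set set" where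
  "edge_boundary V E V' = {{u, v} | u v. {u, v} \<in> E \<and> u \<in> V' \<and> v \<in> V - V'}"

definition expander :: "real \<Rightarrow> 'a set \<Rightarrow> 'a set set \<Rightarrow> bool" where
  "expander c V E \<longleftrightarrow>
     (\<forall>V' \<subseteq> V. real (card V') \<le> real (card V) / 2 \<longrightarrow>
        real (card (edge_boundary V E V')) \<ge> c * real (card V'))"

section \<open>Clauses and SubCubeSums refutations\<close>

datatype 'v literal = Pos (lit_var: 'v) | Neg (lit_var: 'v)

type_synonym 'v clause = "'v literal set"

fun lit_true :: "('v \<Rightarrow> bool) \<Rightarrow> 'v literal \<Rightarrow> bool" where
  "lit_true \<alpha> (Pos x) = \<alpha> x"
| "lit_true \<alpha> (Neg x) = (\<not> \<alpha> x)"

definition falsifies :: "('v \<Rightarrow> bool) \<Rightarrow> 'v clause \<Rightarrow> bool" where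
  "falsifies \<alpha> C \<longleftrightarrow> (\<forall>l\<in>C. \<not> lit_true \<alpha> l)"

definition tautologous :: "'v clause \<Rightarrow> bool" where
  "tautologous C \<longleftrightarrow> (\<exists>x. Pos x \<in> C \<and> Neg x \<in> C)"

definition viol :: "'v clause multiset \<Rightarrow> ('v \<Rightarrow> bool) \<Rightarrow> nat" where
  "viol F \<alpha> = size (filter_mset (falsifies \<alpha>) F)"

text \<open>
  Assignments to the variables in \<open>X\<close> are represented by functions on the whole variable type;
  for clauses over \<open>X\<close> the values outside \<open>X\<close> have no influence on \<^const>\<open>viol\<close>.
  Unsatisfiability of \<open>F\<close> is implied by the defining identity.
\<close>

definition subcubesums_refutation ::
    "'v set \<Rightarrow> 'v clause multiset \<Rightarrow> 'v clause multiset \<Rightarrow> bool" where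
  "subcubesums_refutation X F \<C> \<longleftrightarrow>
     (\<forall>C \<in># \<C>. lit_var ` C \<subseteq> X \<and> \<not> tautologous C) \<and>
     (\<forall>\<alpha>. viol F \<alpha> = 1 + viol \<C> \<alpha>)"

section \<open>Tseitin contradictions\<close>

definition blocking_clause :: "'v set \<Rightarrow> ('v \<Rightarrow> bool) \<Rightarrow> 'v clause" where
  "blocking_clause I \<rho> = (\<lambda>x. if \<rho> x then Neg x else Pos x) ` I"

lemma falsifies_blocking_clause:
  "falsifies \<alpha> (blocking_clause I \<rho>) \<longleftrightarrow> (\<forall>x\<in>I. \<alpha> x = \<rho> x)"
  unfolding falsifies_def blocking_clause_def ball_simps by (rule ball_cong) auto

text \<open>
  The charge \<open>b\<close> takes values in \<open>{0, 1}\<close>. The variables are the edges themselves.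
\<close>

definition tseitin_vertex_clauses :: "'a set set \<Rightarrow> ('a \<Rightarrow> nat) \<Rightarrow> 'a \<Rightarrow> 'a set clause set" where
  "tseitin_vertex_clauses E b u =
     blocking_clause (incident_edges E u) `
       {\<rho> \<in> incident_edges E u \<rightarrow>\<^sub>E UNIV.
          (\<Sum>e\<in>incident_edges E u. of_bool (\<rho> e)) mod 2 \<noteq> b u}"

definition tseitin :: "'a set \<Rightarrow> 'a set set \<Rightarrow> ('a \<Rightarrow> nat) \<Rightarrow> 'a set clause multiset" where
  "tseitin V E b = (\<Sum>u\<in>V. mset_set (tseitin_vertex_clauses E b u))"

lemma tseitin_vertex_clauses_satisfied_iff:
  "(\<forall>C \<in> tseitin_vertex_clauses E b u. \<not> falsifies \<alpha> C) \<longleftrightarrow>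
     (\<Sum>e\<in>incident_edges E u. of_bool (\<alpha> e)) mod 2 = b u"
proof
  let ?I = "incident_edges E u"
  assume L: "\<forall>C \<in> tseitin_vertex_clauses E b u. \<not> falsifies \<alpha> C"
  show "(\<Sum>e\<in>?I. of_bool (\<alpha> e)) mod 2 = b u"
  proof (rule ccontr)
    assume ne: "(\<Sum>e\<in>?I. of_bool (\<alpha> e)) mod 2 \<noteq> b u"
    define \<rho> where "\<rho> = restrict \<alpha> ?I"
    have "(\<Sum>e\<in>?I. of_bool (\<rho> e) :: nat) = (\<Sum>e\<in>?I. of_bool (\<alpha> e))"
      unfolding \<rho>_def by (rule sum.cong) simp_all
    with ne have "(\<Sum>e\<in>?I. of_bool (\<rho> e)) mod 2 \<noteq> b u" by simp
    moreover have "\<rho> \<in> ?I \<rightarrow>\<^sub>E UNIV"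
      unfolding \<rho>_def by simp
    ultimately have mem: "blocking_clause ?I \<rho> \<in> tseitin_vertex_clauses E b u"
      unfolding tseitin_vertex_clauses_def by (intro imageI CollectI conjI)
    have "falsifies \<alpha> (blocking_clause ?I \<rho>)"
      unfolding falsifies_blocking_clause \<rho>_def by simp
    with bspec[OF L mem] show False by (rule notE)
  qed
next
  let ?I = "incident_edges E u"
  assume R: "(\<Sum>e\<in>?I. of_bool (\<alpha> e)) mod 2 = b u"
  show "\<forall>C \<in> tseitin_vertex_clauses E b u. \<not> falsifies \<alpha> C"
  proof (intro ballI notI)
    fix C assume "C \<in> tseitin_vertex_clauses E b u" and fal: "falsifies \<alpha> C"
    then obtain \<rho> where C: "C = blocking_clause ?I \<rho>"
      and ne: "(\<Sum>e\<in>?I. of_bool (\<rho> e)) mod 2 \<noteq> b u"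
      unfolding tseitin_vertex_clauses_def by (elim imageE CollectE conjE)
    have "\<forall>e\<in>?I. \<alpha> e = \<rho> e"
      using fal unfolding C falsifies_blocking_clause .
    then have "(\<Sum>e\<in>?I. of_bool (\<rho> e) :: nat) = (\<Sum>e\<in>?I. of_bool (\<alpha> e))"
      by (intro sum.cong) simp_all
    with R ne show False by simp
  qed
qed

end

theory Submission imports Defs begin

text \<open>
  For \<open>j = 3, 5\<close> consider the assignments violating exactly \<open>j\<close> vertices. A refutation covers each of
  them \<open>j - 1\<close> times, so it covers the violation-5 assignments only twice as densely as the
  violation-3 ones. A clause mentioning at most \<open>c n / 10\<close> edges cannot achieve this: deleting its
  edges leaves a component \<open>K\<close> with at least \<open>9 n / 10\<close> vertices, and since no assignment with a
  single violated vertex may falsify the clause, a violated triple falsifying it meets \<open>K\<close> at most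
  once. Flipping a path inside \<open>K\<close> adds two violated vertices, which makes the density larger by a
  factor of about \<open>(10 / 3) (9 / 10)\<^sup>2 > 2\<close>. Hence wide clauses must cover a constant fraction of the
  violation-3 assignments, of which there are at least \<open>2 ^ (|E| - n)\<close>, while each wide clause is
  falsified by at most \<open>2 ^ (|E| - c n / 10)\<close> assignments.
\<close>

section \<open>Vertices of odd degree\<close>

text \<open>An assignment is encoded as the set of its true edges, and this is its boundary modulo
  2. With charge 1 everywhere, the vertices of \<open>V\<close> outside it are the violated
  ones.\<close>

definition odd_verts :: "'a set set \<Rightarrow> 'a set" where
  "odd_verts y = {v. odd (card (incident_edges y v))}"

lemma odd_card_sym_diff:
  assumes "finite A" "finite B"
  shows "odd (card (sym_diff A B)) \<longleftrightarrow> odd (card A) \<noteq> odd (card B)"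
proof -
  have 1: "card (sym_diff A B) = card (A - B) + card (B - A)"
    using assms by (intro card_Un_disjoint) auto
  have 2: "card A = card (A - B) + card (A \<inter> B)" "card B = card (B - A) + card (A \<inter> B)"
    using assms by (metis Diff_Diff_Int Int_commute add.commute card_Diff_subset card_mono
      Diff_subset finite_Diff finite_Int inf_le1 le_add_diff_inverse)+
  show ?thesis unfolding 1 2 by auto
qed

text \<open>Linearity of the boundary map over the two-element field: flipping the edges of
  \<open>y\<close> toggles violation exactly at \<open>odd_verts y\<close>.\<close>

lemma odd_verts_sym_diff:
  assumes "finite x" "finite y"
  shows "odd_verts (sym_diff x y) = sym_diff (odd_verts x) (odd_verts y)"
proof -
  have "odd (card (incident_edges (sym_diff x y) v)) \<longleftrightarrow>
          odd (card (incident_edges x v)) \<noteq> odd (card (incident_edges y v))" for v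
  proof -
    have "incident_edges (sym_diff x y) v = sym_diff (incident_edges x v) (incident_edges y v)"
      by (auto simp: incident_edges_def)
    then show ?thesis
      using odd_card_sym_diff[of "incident_edges x v" "incident_edges y v"] assms
      by (simp add: incident_edges_def)
  qed
  then show ?thesis by (auto simp: odd_verts_def)
qed

lemma odd_verts_empty [simp]: "odd_verts {} = {}"
  by (simp add: odd_verts_def incident_edges_def)

lemma odd_verts_singleton: "odd_verts {e} = e"
proof -
  have "incident_edges {e} v = (if v \<in> e then {e} else {})" for v
    by (auto simp: incident_edges_def)
  then show ?thesis by (auto simp: odd_verts_def)
qed

lemma odd_verts_subset:
  assumes "y \<subseteq> nsets V 2"
  shows "odd_verts y \<subseteq> V"
proof
  fix v assume "v \<in> odd_verts y"
  then have "incident_edges y v \<noteq> {}" by (force simp: odd_verts_def)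
  then show "v \<in> V" using assms by (auto simp: incident_edges_def nsets_def)
qed

lemma simple_graph_finite_edges: "simple_graph V E \<Longrightarrow> finite E"
  unfolding simple_graph_def using finite_imp_finite_nsets finite_subset by blast

section \<open>Violated Tseitin clauses\<close>

lemma viol_add: "viol (F + G) \<alpha> = viol F \<alpha> + viol G \<alpha>"
  by (simp add: viol_def)

lemma viol_sum: "viol (\<Sum>u\<in>V. F u) \<alpha> = (\<Sum>u\<in>V. viol (F u) \<alpha>)"
  by (induction V rule: infinite_finite_induct) (simp_all add: viol_add, simp_all add: viol_def)

lemma finite_tseitin_vertex_clauses:
  assumes "finite E"
  shows "finite (tseitin_vertex_clauses E b u)"
proof -
  have "finite (incident_edges E u \<rightarrow>\<^sub>E (UNIV :: bool set))"
    using assms by (intro finite_PiE) (auto simp: incident_edges_def)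
  then show ?thesis unfolding tseitin_vertex_clauses_def by simp
qed

lemma viol_tseitin_vertex:
  assumes "finite E" "x \<subseteq> E"
  shows "viol (mset_set (tseitin_vertex_clauses E (\<lambda>_. 1) u)) (\<lambda>e. e \<in> x)
           = of_bool (u \<notin> odd_verts x)"
proof -
  let ?I = "incident_edges E u" and ?\<alpha> = "\<lambda>e. e \<in> x"
  let ?T = "{C \<in> tseitin_vertex_clauses E (\<lambda>_. 1) u. falsifies ?\<alpha> C}"
  have I: "finite ?I" using assms by (simp add: incident_edges_def)
  have "(\<Sum>e\<in>?I. of_bool (?\<alpha> e) :: nat) = card (incident_edges x u)"
  proof -
    have "(\<Sum>e\<in>?I. of_bool (?\<alpha> e) :: nat) = card (?I \<inter> {e. e \<in> x})"
      using I by simp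
    also have "?I \<inter> {e. e \<in> x} = incident_edges x u"
      using assms by (auto simp: incident_edges_def)
    finally show ?thesis .
  qed
  then have sat: "?T = {} \<longleftrightarrow> u \<in> odd_verts x"
    using tseitin_vertex_clauses_satisfied_iff[of E "\<lambda>_. 1" u ?\<alpha>]
    by (auto simp: odd_verts_def odd_iff_mod_2_eq_one)
  \<comment> \<open>A falsified blocking clause determines the assignment on the incident edges, so
    a violated vertex contributes exactly one falsified clause.\<close>
  have "?T \<subseteq> {blocking_clause ?I ?\<alpha>}"
  proof
    fix C assume "C \<in> ?T"
    then obtain \<rho> where C: "C = blocking_clause ?I \<rho>" and "falsifies ?\<alpha> C"
      unfolding tseitin_vertex_clauses_def by blast
    then have "\<forall>e\<in>?I. ?\<alpha> e = \<rho> e" by (simp add: falsifies_blocking_clause)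
    then show "C \<in> {blocking_clause ?I ?\<alpha>}"
      unfolding C blocking_clause_def by (auto intro!: image_cong)
  qed
  then have "?T = {} \<or> ?T = {blocking_clause ?I ?\<alpha>}"
    by (rule subset_singletonD)
  then have "card ?T = of_bool (?T \<noteq> {})"
    by (elim disjE) (simp_all only: card.empty, simp_all)
  then show ?thesis
    using finite_tseitin_vertex_clauses[OF assms(1)] sat by (simp add: viol_def)
qed

lemma viol_tseitin:
  assumes "simple_graph V E" "x \<subseteq> E"
  shows "viol (tseitin V E (\<lambda>_. 1)) (\<lambda>e. e \<in> x) = card (V - odd_verts x)"
proof -
  have "finite E" and V: "finite V"
    using assms simple_graph_finite_edges by (auto simp: simple_graph_def)
  then have "viol (tseitin V E (\<lambda>_. 1)) (\<lambda>e. e \<in> x) = (\<Sum>u\<in>V. of_bool (u \<notin> odd_verts x))"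
    unfolding tseitin_def viol_sum using assms(2) by (intro sum.cong viol_tseitin_vertex refl)
  also have "\<dots> = card (V \<inter> {u. u \<notin> odd_verts x})"
    using V by simp
  also have "V \<inter> {u. u \<notin> odd_verts x} = V - odd_verts x" by auto
  finally show ?thesis .
qed

section \<open>Components of expanders after deleting few edges\<close>

text \<open>A set closed under \<open>H\<close> has all its boundary edges among the at most
  \<open>c * q\<close> deleted ones, and so does its complement. Expansion then bounds by
  \<open>q\<close> whichever of the two has at most half of the vertices.\<close>

lemma expander_closed_sets:
  assumes G: "simple_graph V E" "expander c V E" "c > 0"
    and q: "real (card (E - H)) \<le> c * q"
    and U: "U \<subseteq> V" "\<And>u v. {u, v} \<in> H \<Longrightarrow> u \<in> U \<Longrightarrow> v \<in> U"
  shows "real (card U) \<le> q \<or> real (card U) \<ge> real (card V) - q"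
proof -
  have fin: "finite V" "finite E"
    using G simple_graph_finite_edges by (auto simp: simple_graph_def)
  have small: "real (card U') \<le> q"
    if "real (card U') \<le> real (card V) / 2" "U' \<subseteq> V" "edge_boundary V E U' \<subseteq> E - H" for U'
  proof -
    have "c * real (card U') \<le> real (card (edge_boundary V E U'))"
      using G that by (simp add: expander_def)
    also have "\<dots> \<le> real (card (E - H))"
      using that fin by (simp add: card_mono)
    also have "\<dots> \<le> c * q" by fact
    finally show ?thesis using G by simp
  qed
  have card: "real (card (V - U)) = real (card V) - real (card U)"
    using fin U by (simp add: card_Diff_subset finite_subset card_mono of_nat_diff)
  have "edge_boundary V E U \<subseteq> E - H" "edge_boundary V E (V - U) \<subseteq> E - H"
    using U unfolding edge_boundary_def by (fastforce simp: insert_commute)+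
  then show ?thesis
    using small[of U] small[of "V - U"] U card
    by (cases "real (card U) \<le> real (card V) / 2") (auto simp: field_simps)
qed

text \<open>\<open>K\<close> is a smallest closed set with more than half of the vertices; splitting
  it by reachability from a vertex would contradict minimality. Connectedness is stated through edge
  sets with boundary \<open>{u, v}\<close>, since these are what gets flipped later.\<close>

lemma expander_giant_component:
  assumes G: "simple_graph V E" "expander c V E" "c > 0" and H: "H \<subseteq> E"
    and q: "real (card (E - H)) \<le> c * q" "0 \<le> q" "q < real (card V) / 4"
  obtains K where "K \<subseteq> V" "real (card K) \<ge> real (card V) - q"
    "\<And>u v. u \<in> K \<Longrightarrow> v \<in> K \<Longrightarrow> u \<noteq> v \<Longrightarrow> \<exists>y\<subseteq>H. odd_verts y = {u, v}"
proof -
  have fin: "finite V" "finite E"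
    using G simple_graph_finite_edges by (auto simp: simple_graph_def)
  then have "finite H" using H finite_subset by blast
  define cl where "cl U \<longleftrightarrow> U \<subseteq> V \<and> (\<forall>u v. {u, v} \<in> H \<longrightarrow> u \<in> U \<longrightarrow> v \<in> U)" for U
  \<comment> \<open>Reachability from \<open>u\<close> inside \<open>H\<close>. Writing
    \<open>sym_diff {u} {v}\<close> covers \<open>v = u\<close> as well, with
    \<open>y = {}\<close>.\<close>
  define R where "R u = {v \<in> V. \<exists>y\<subseteq>H. odd_verts y = sym_diff {u} {v}}" for u
  have HV: "H \<subseteq> nsets V 2" using G H by (auto simp: simple_graph_def)
  have dich: "real (card U) \<le> q \<or> real (card U) \<ge> real (card V) - q" if "cl U" for U
    using expander_closed_sets[OF G q(1), of U] that unfolding cl_def by blast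
  have Rcl: "cl (R u)" for u
    unfolding cl_def
  proof (intro conjI allI impI)
    show "R u \<subseteq> V" by (auto simp: R_def)
    fix v w assume vw: "{v, w} \<in> H" and "v \<in> R u"
    then obtain y where y: "y \<subseteq> H" "odd_verts y = sym_diff {u} {v}" by (auto simp: R_def)
    have "{v, w} \<in> nsets V 2" using vw HV by blast
    then have "v \<noteq> w" "w \<in> V" unfolding doubleton_in_nsets_2 by simp_all
    moreover have "odd_verts (sym_diff y {{v, w}}) = sym_diff (sym_diff {u} {v}) {v, w}"
      using odd_verts_sym_diff[of y "{{v, w}}"] y \<open>finite H\<close>
      by (simp add: odd_verts_singleton finite_subset)
    moreover have "sym_diff (sym_diff {u} {v}) {v, w} = sym_diff {u} {w}"
      using \<open>v \<noteq> w\<close> by auto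
    ultimately show "w \<in> R u"
      using y vw unfolding R_def by (intro CollectI conjI exI[of _ "sym_diff y {{v, w}}"]) auto
  qed
  have "cl V" using HV by (auto simp: cl_def)
  then have "cl V \<and> real (card V) > real (card V) / 2" using q by auto
  then obtain K where K: "cl K" "real (card K) > real (card V) / 2"
    and min: "\<And>U. cl U \<Longrightarrow> real (card U) > real (card V) / 2 \<Longrightarrow> card K \<le> card U"
    using ex_has_least_nat[of "\<lambda>U. cl U \<and> real (card U) > real (card V) / 2" V card] by blast
  have KV: "K \<subseteq> V" "finite K" using K fin by (auto simp: cl_def intro: finite_subset)
  have Kbig: "real (card K) \<ge> real (card V) - q" using dich[OF K(1)] K q by auto
  have "\<exists>y\<subseteq>H. odd_verts y = {u, v}" if uv: "u \<in> K" "v \<in> K" "u \<noteq> v" for u v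
  proof -
    have cl1: "cl (K \<inter> R u)"
      using K(1) Rcl[of u] unfolding cl_def by blast
    have cl2: "cl (K - R u)"
      using K(1) Rcl[of u] unfolding cl_def by (fastforce simp: insert_commute)
    have u: "u \<in> K \<inter> R u"
      using uv KV by (auto simp: R_def intro!: exI[of _ "{}"])
    have split: "card K = card (K \<inter> R u) + card (K - R u)"
      using KV card_Int_Diff by blast
    have pos: "card (K \<inter> R u) > 0" using u KV by (auto simp: card_gt_0_iff)
    have "\<not> real (card (K - R u)) > real (card V) / 2"
      using min[OF cl2] split pos by linarith
    then have "real (card (K - R u)) \<le> q" using dich[OF cl2] q by linarith
    \<comment> \<open>Here \<open>q < card V / 4\<close> matters: at least
      \<open>card V - 2 * q\<close> vertices remain, which is more than half.\<close>
    then have "real (card (K \<inter> R u)) > real (card V) / 2"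
      using split Kbig q by linarith
    then have "card (K - R u) = 0" using min[OF cl1] split by linarith
    then have "v \<in> R u" using KV uv by auto
    then obtain y where "y \<subseteq> H" "odd_verts y = sym_diff {u} {v}" by (auto simp: R_def)
    then show ?thesis using uv by (intro exI[of _ y]) auto
  qed
  then show ?thesis using that KV Kbig by blast
qed

text \<open>Pair off the vertices of \<open>T\<close> and add up the connecting edge sets modulo 2;
  evenness lets the pairing end at the empty set.\<close>

lemma odd_verts_surj:
  assumes "finite H" and conn: "\<And>u v. u \<in> V \<Longrightarrow> v \<in> V \<Longrightarrow> u \<noteq> v \<Longrightarrow> \<exists>y\<subseteq>H. odd_verts y = {u, v}"
    and "finite T" "T \<subseteq> V" "even (card T)"
  shows "\<exists>y\<subseteq>H. odd_verts y = T"
  using assms(3-5)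
proof (induction "card T" arbitrary: T rule: less_induct)
  case less
  show ?case
  proof (cases "T = {}")
    case True
    then show ?thesis using odd_verts_empty by blast
  next
    case False
    then obtain u where u: "u \<in> T" by auto
    have "T \<noteq> {u}" using less.prems by auto
    then obtain v where v: "v \<in> T" "v \<noteq> u" using u by auto
    define T' where "T' = T - {u, v}"
    have T': "finite T'" "u \<notin> T'" "v \<notin> T'" "T' \<subseteq> V"
      using less.prems(1,2) by (auto simp: T'_def)
    have "card T = card (insert u (insert v T'))"
      using u v by (intro arg_cong[of _ _ card]) (auto simp: T'_def)
    then have c: "card T = card T' + 2" using v T' by simp
    then have "even (card T')" "card T' < card T" using less.prems(3) by simp_all
    then obtain y where y: "y \<subseteq> H" "odd_verts y = T'"
      using less.hyps[OF _ T'(1,4)] by blast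
    have "u \<in> V" "v \<in> V" "u \<noteq> v" using u v less.prems(2) by blast+
    then obtain z where z: "z \<subseteq> H" "odd_verts z = {u, v}"
      using conn by blast
    have "odd_verts (sym_diff y z) = sym_diff T' {u, v}"
      using odd_verts_sym_diff[of y z] y z \<open>finite H\<close> by (simp add: finite_subset)
    also have "\<dots> = T" using u v by (auto simp: T'_def)
    finally have "odd_verts (sym_diff y z) = T" .
    moreover have "sym_diff y z \<subseteq> H" using y z by blast
    ultimately show ?thesis by blast
  qed
qed

section \<open>Subcubes\<close>

definition falsifying :: "'v set \<Rightarrow> 'v clause \<Rightarrow> 'v set set" where
  "falsifying E C = {x. x \<subseteq> E \<and> falsifies (\<lambda>e. e \<in> x) C}"

text \<open>The empty clause is falsified by every assignment, so \<open>C = {}\<close> gives the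
  whole level \<open>j\<close>.\<close>

definition falsifying_level :: "'a set \<Rightarrow> 'a set set \<Rightarrow> 'a set clause \<Rightarrow> nat \<Rightarrow> 'a set set set" where
  "falsifying_level V E C j = {x \<in> falsifying E C. card (V - odd_verts x) = j}"

lemma finite_falsifying: "finite E \<Longrightarrow> finite (falsifying E C)"
  by (rule finite_subset[of _ "Pow E"]) (auto simp: falsifying_def)

lemma falsifying_empty: "falsifying E {} = Pow E"
  by (auto simp: falsifying_def falsifies_def)

lemma falsifies_cong:
  assumes "\<And>e. e \<in> lit_var ` C \<Longrightarrow> \<alpha> e = \<beta> e"
  shows "falsifies \<alpha> C = falsifies \<beta> C"
proof -
  have "lit_true \<alpha> l = lit_true \<beta> l" if "l \<in> C" for l
    using assms[OF imageI[OF that]] by (cases l) auto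
  then show ?thesis by (simp add: falsifies_def)
qed

lemma falsifying_agree:
  assumes "x \<in> falsifying E C" "x' \<in> falsifying E C" "e \<in> lit_var ` C"
  shows "e \<in> x \<longleftrightarrow> e \<in> x'"
proof -
  obtain l where "l \<in> C" "e = lit_var l" using assms by auto
  then show ?thesis
    using assms by (cases l) (auto simp: falsifying_def falsifies_def dest!: bspec)
qed

lemma falsifying_shift:
  assumes "x \<in> falsifying E C" "y \<subseteq> E - lit_var ` C"
  shows "sym_diff x y \<in> falsifying E C"
proof -
  have "falsifies (\<lambda>e. e \<in> sym_diff x y) C = falsifies (\<lambda>e. e \<in> x) C"
    using assms(2) by (intro falsifies_cong) auto
  then show ?thesis using assms by (auto simp: falsifying_def)
qed

lemma card_falsifying_le:
  assumes "finite E"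
  shows "card (falsifying E C) \<le> 2 ^ card (E - lit_var ` C)"
proof -
  have "inj_on (\<lambda>x. x - lit_var ` C) (falsifying E C)"
  proof (rule inj_onI)
    fix x x' assume "x \<in> falsifying E C" "x' \<in> falsifying E C" "x - lit_var ` C = x' - lit_var ` C"
    then show "x = x'" using falsifying_agree[of x E C x'] by blast
  qed
  moreover have "(\<lambda>x. x - lit_var ` C) ` falsifying E C \<subseteq> Pow (E - lit_var ` C)"
    by (auto simp: falsifying_def)
  ultimately show ?thesis
    using assms card_inj_on_le card_Pow by (metis finite_Diff finite_Pow_iff)
qed

text \<open>Two assignments in the subcube with the same violated set differ by an element of the
  cycle space of the unmentioned edges, and adding such an element changes neither property. Each
  nonempty fibre is thus a coset of that space.\<close>

lemma card_falsifying_fibre: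
  assumes G: "simple_graph V E" and S: "S \<in> (\<lambda>x. V - odd_verts x) ` falsifying E C"
  shows "card {x \<in> falsifying E C. V - odd_verts x = S}
           = card {y. y \<subseteq> E - lit_var ` C \<and> odd_verts y = {}}"
proof -
  obtain x0 where x0: "x0 \<in> falsifying E C" "V - odd_verts x0 = S" using S by auto
  have fin: "finite E" using G by (rule simple_graph_finite_edges)
  have sub: "x \<subseteq> E" "finite x" "odd_verts x \<subseteq> V" if "x \<in> falsifying E C" for x
  proof -
    show x: "x \<subseteq> E" using that by (simp add: falsifying_def)
    then show "finite x" using fin by (rule finite_subset)
    show "odd_verts x \<subseteq> V"
      using x G by (intro odd_verts_subset) (auto simp: simple_graph_def)
  qed
  let ?Z = "{y. y \<subseteq> E - lit_var ` C \<and> odd_verts y = {}}"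
  let ?F = "{x \<in> falsifying E C. V - odd_verts x = S}"
  have ZF: "sym_diff x0 y \<in> ?F" if "y \<in> ?Z" for y
  proof -
    have y: "y \<subseteq> E - lit_var ` C" "odd_verts y = {}" using that by simp_all
    then have "finite y" using finite_subset[OF y(1)] fin by simp
    then have "V - odd_verts (sym_diff x0 y) = S"
      using odd_verts_sym_diff[of x0 y] sub(2)[OF x0(1)] x0(2) y(2) by simp
    then show ?thesis using falsifying_shift[OF x0(1) y(1)] by simp
  qed
  have FZ: "sym_diff x0 x \<in> ?Z" if "x \<in> ?F" for x
  proof -
    have x: "x \<in> falsifying E C" "V - odd_verts x = S" using that by simp_all
    have "sym_diff x0 x \<subseteq> E - lit_var ` C"
    proof
      fix e assume "e \<in> sym_diff x0 x"
      then show "e \<in> E - lit_var ` C"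
        using falsifying_agree[OF x0(1) x(1), of e] sub(1)[OF x0(1)] sub(1)[OF x(1)] by blast
    qed
    moreover have "odd_verts x = odd_verts x0"
      using sub(3)[OF x0(1)] sub(3)[OF x(1)] x(2) x0(2) by blast
    then have "odd_verts (sym_diff x0 x) = {}"
      using odd_verts_sym_diff[of x0 x] sub(2)[OF x0(1)] sub(2)[OF x(1)] by simp
    ultimately show ?thesis by simp
  qed
  have "sym_diff x0 (sym_diff x0 y) = y" for y by blast
  then have "bij_betw (sym_diff x0) ?Z ?F"
    using ZF FZ by (intro bij_betwI[where g = "sym_diff x0"] funcsetI)
  then show ?thesis by (rule bij_betw_same_card[symmetric])
qed

text \<open>All fibres have the same size, independent of \<open>j\<close>, so comparing two levels
  within a subcube reduces to counting violated sets.\<close>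

lemma card_falsifying_level:
  assumes G: "simple_graph V E"
  shows "card (falsifying_level V E C j)
    = card {S \<in> (\<lambda>x. V - odd_verts x) ` falsifying E C. card S = j}
      * card {y. y \<subseteq> E - lit_var ` C \<and> odd_verts y = {}}"
proof -
  let ?S = "{S \<in> (\<lambda>x. V - odd_verts x) ` falsifying E C. card S = j}"
  let ?f = "\<lambda>S. {x \<in> falsifying E C. V - odd_verts x = S}"
  have fin: "finite (falsifying E C)"
    using G by (intro finite_falsifying simple_graph_finite_edges)
  have "falsifying_level V E C j = (\<Union>S\<in>?S. ?f S)"
    by (auto simp: falsifying_level_def)
  also have "card \<dots> = (\<Sum>S\<in>?S. card (?f S))"
    using fin by (intro card_UN_disjoint) auto
  also have "\<dots> = (\<Sum>S\<in>?S. card {y. y \<subseteq> E - lit_var ` C \<and> odd_verts y = {}})"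
    using card_falsifying_fibre[OF G] by (intro sum.cong) auto
  finally show ?thesis by simp
qed

lemma card_off_diagonal:
  assumes "finite A"
  shows "card {p \<in> A \<times> A. fst p \<noteq> snd p} = card A * (card A - 1)"
proof -
  have "{p \<in> A \<times> A. fst p \<noteq> snd p} = Sigma A (\<lambda>a. A - {a})" by auto
  then show ?thesis using assms by simp
qed

text \<open>No member of the family of size 3 meets \<open>K\<close> twice, since otherwise removing two such
  elements leaves a singleton. Hence a member of size 5 arises from one of size 3 by adding an
  ordered pair from \<open>K\<close> in at most \<open>3 \<cdot> 2\<close> ways.\<close>

lemma pair_exchange:
  assumes "finite V" "K \<subseteq> V" "\<S> \<subseteq> Pow V"
    and shift: "\<And>S u v. S \<in> \<S> \<Longrightarrow> u \<in> K \<Longrightarrow> v \<in> K \<Longrightarrow> u \<noteq> v \<Longrightarrow> sym_diff S {u, v} \<in> \<S>"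
    and no1: "\<And>S. S \<in> \<S> \<Longrightarrow> card S \<noteq> 1"
  shows "(card K - 1) * (card K - 2) * card {S \<in> \<S>. card S = 3} \<le> 6 * card {S \<in> \<S>. card S = 5}"
proof -
  define P where "P A = {p \<in> A \<times> A. fst p \<noteq> snd p}" for A :: "'a set"
  let ?S3 = "{S \<in> \<S>. card S = 3}" and ?S5 = "{S \<in> \<S>. card S = 5}"
  \<comment> \<open>The ordered pairs that can be removed again from \<open>S\<close> without
    leaving the family; they count the preimages of \<open>S\<close> under adding a pair.\<close>
  define Q where "Q S = {p \<in> P (S \<inter> K). S - {fst p, snd p} \<in> \<S>}" for S
  have finS: "finite S" if "S \<in> \<S>" for S
    using that assms(3) by (intro finite_subset[OF _ assms(1)]) blast
  have finK: "finite K" by (rule finite_subset[OF assms(2,1)])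
  have fS: "finite \<S>" using finite_subset[OF assms(3)] assms(1) by simp
  have le1: "card (S \<inter> K) \<le> 1" if "S \<in> ?S3" for S
  proof (rule ccontr)
    have "finite (S \<inter> K)" using finK by simp
    moreover assume "\<not> card (S \<inter> K) \<le> 1"
    ultimately obtain u v where uv: "u \<in> S \<inter> K" "v \<in> S \<inter> K" "u \<noteq> v"
      unfolding One_nat_def card_le_Suc0_iff_eq[OF \<open>finite (S \<inter> K)\<close>] by blast
    then have "sym_diff S {u, v} = S - {u, v}" by blast
    moreover have "card (S - {u, v}) = 1" using uv that by (subst card_Diff_subset) auto
    moreover have "sym_diff S {u, v} \<in> \<S>" using shift[of S u v] uv that by blast
    ultimately show False using no1[of "S - {u, v}"] by simp
  qed
  have "(card K - 1) * (card K - 2) * card ?S3 = (\<Sum>S\<in>?S3. (card K - 1) * (card K - 2))"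
    by simp
  also have "\<dots> \<le> (\<Sum>S\<in>?S3. card (P (K - S)))"
  proof (rule sum_mono)
    fix S assume S: "S \<in> ?S3"
    have "card K \<le> card (K - S) + 1"
      using le1[OF S] card_Int_Diff[OF finK, of S] by (simp add: Int_commute)
    then have "card K - 1 \<le> card (K - S)" "card K - 2 \<le> card (K - S) - 1" by auto
    then show "(card K - 1) * (card K - 2) \<le> card (P (K - S))"
      unfolding P_def using card_off_diagonal[of "K - S"] finK by (simp add: mult_le_mono)
  qed
  also have "\<dots> = card (Sigma ?S3 (\<lambda>S. P (K - S)))"
    using fS finK by (simp add: P_def)
  also have "\<dots> \<le> card (Sigma ?S5 Q)"
  \<comment> \<open>Keeping the added pair in the image makes the map injective, since the pair can
    be subtracted again.\<close>
  proof (rule card_inj_on_le[where f = "\<lambda>(S, p). (S \<union> {fst p, snd p}, p)"])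
    show "inj_on (\<lambda>(S, p). (S \<union> {fst p, snd p}, p)) (Sigma ?S3 (\<lambda>S. P (K - S)))"
      by (rule inj_on_inverseI[where g = "\<lambda>(T, p). (T - {fst p, snd p}, p)"]) (auto simp: P_def)
    show "(\<lambda>(S, p). (S \<union> {fst p, snd p}, p)) ` Sigma ?S3 (\<lambda>S. P (K - S)) \<subseteq> Sigma ?S5 Q"
    proof clarify
      fix S u v assume S: "S \<in> \<S>" "card S = 3" and p: "(u, v) \<in> P (K - S)"
      then have uv: "u \<in> K" "v \<in> K" "u \<notin> S" "v \<notin> S" "u \<noteq> v" by (auto simp: P_def)
      have "sym_diff S {u, v} = S \<union> {u, v}" using uv by blast
      then have "S \<union> {u, v} \<in> \<S>" using shift[OF S(1) uv(1,2,5)] by simp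
      moreover have "card (S \<union> {u, v}) = 5" using S uv finS by simp
      moreover have "S \<union> {u, v} - {u, v} = S" using uv by auto
      ultimately show "S \<union> {fst (u, v), snd (u, v)} \<in> ?S5 \<and> (u, v) \<in> Q (S \<union> {fst (u, v), snd (u, v)})"
        using S uv by (simp add: Q_def P_def)
    qed
    show "finite (Sigma ?S5 Q)"
      using fS finK by (intro finite_SigmaI) (auto simp: Q_def P_def)
  qed
  also have "\<dots> = (\<Sum>S\<in>?S5. card (Q S))"
    using fS finK by (simp add: Q_def P_def)
  also have "\<dots> \<le> (\<Sum>S\<in>?S5. 6)"
  proof (rule sum_mono)
    fix S assume S: "S \<in> ?S5"
    show "card (Q S) \<le> 6"
    proof (cases "Q S = {}")
      case False
      \<comment> \<open>Removing one such pair leaves a 3-element member, which meets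
        \<open>K\<close> at most once, so \<open>S\<close> meets \<open>K\<close> at most three
        times.\<close>
      then obtain u v where uv: "u \<in> S \<inter> K" "v \<in> S \<inter> K" "u \<noteq> v" "S - {u, v} \<in> \<S>"
        by (auto simp: Q_def P_def)
      have "card (S - {u, v}) = 3" using uv S by (subst card_Diff_subset) auto
      then have "card ((S - {u, v}) \<inter> K) \<le> 1" using le1[of "S - {u, v}"] uv(4) by simp
      moreover have "card (S \<inter> K - {u, v}) = card (S \<inter> K) - 2"
        using uv by (subst card_Diff_subset) auto
      moreover have "S \<inter> K - {u, v} = (S - {u, v}) \<inter> K" by blast
      ultimately have c: "card (S \<inter> K) \<le> 3" by simp
      have "card (Q S) \<le> card (P (S \<inter> K))"
        using finK by (intro card_mono) (auto simp: Q_def P_def)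
      also have "\<dots> = card (S \<inter> K) * (card (S \<inter> K) - 1)"
        unfolding P_def using finK by (simp add: card_off_diagonal)
      also have "\<dots> \<le> 3 * (3 - 1)" using c by (intro mult_le_mono) auto
      finally show ?thesis by simp
    qed simp
  qed
  finally show ?thesis by (simp add: mult.commute)
qed

section \<open>Counting assignments by the number of violated vertices\<close>

lemma viol_eq_sum_mset: "viol F \<alpha> = (\<Sum>C\<in>#F. of_bool (falsifies \<alpha> C))"
  by (induction F) (simp_all add: viol_def)

lemma sum_mset_sum_swap: "(\<Sum>C\<in>#F. \<Sum>x\<in>X. f C x :: nat) = (\<Sum>x\<in>X. \<Sum>C\<in>#F. f C x)"
  by (induction F) (simp_all add: sum.distrib)

text \<open>Double counting of pairs of a clause and a level-\<open>j\<close> assignment falsifying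
  it: the refutation identity gives each assignment \<open>j - 1\<close> clauses. For
  \<open>j = 0\<close> the identity forces the level to be empty, so truncated subtraction does no
  harm.\<close>

lemma sum_card_falsifying_level:
  assumes G: "simple_graph V E"
    and ref: "subcubesums_refutation E (tseitin V E (\<lambda>_. 1)) \<C>"
  shows "(\<Sum>C\<in>#\<C>. card (falsifying_level V E C j)) = (j - 1) * card (falsifying_level V E {} j)"
proof -
  let ?X = "falsifying_level V E {} j"
  have fin: "finite ?X"
    using finite_falsifying[OF simple_graph_finite_edges[OF G], of "{}"]
    by (simp add: falsifying_level_def)
  have "card (falsifying_level V E C j) = (\<Sum>x\<in>?X. of_bool (falsifies (\<lambda>e. e \<in> x) C))" for C
  proof -
    have "falsifying_level V E C j = ?X \<inter> {x. falsifies (\<lambda>e. e \<in> x) C}"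
      by (auto simp: falsifying_level_def falsifying_def falsifies_def)
    then show ?thesis using fin by simp
  qed
  then have "(\<Sum>C\<in>#\<C>. card (falsifying_level V E C j)) = (\<Sum>x\<in>?X. viol \<C> (\<lambda>e. e \<in> x))"
    by (simp add: sum_mset_sum_swap viol_eq_sum_mset)
  also have "\<dots> = (\<Sum>x\<in>?X. j - 1)"
  proof (rule sum.cong)
    fix x assume x: "x \<in> ?X"
    then have "x \<subseteq> E" "card (V - odd_verts x) = j"
      by (auto simp: falsifying_level_def falsifying_def)
    then show "viol \<C> (\<lambda>e. e \<in> x) = j - 1"
      using ref viol_tseitin[OF G, of x] unfolding subcubesums_refutation_def
      by (metis add_diff_cancel_left')
  qed simp
  finally show ?thesis by (simp add: mult.commute)
qed

text \<open>The violated sets of the subcube are closed under toggling two vertices of the giant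
  component, so \<open>pair_exchange\<close> applies, and the common fibre size carries its bound
  over to assignments.\<close>

lemma falsifying_level_narrow:
  assumes G: "simple_graph V E" "expander c V E" "c > 0" and n: "card V \<ge> 5"
    and C: "lit_var ` C \<subseteq> E" "real (card (lit_var ` C)) \<le> c * real (card V) / 10"
    and no1: "falsifying_level V E C 1 = {}"
  shows "4 / 5 * ((real (card V) - 3) * (real (card V) - 4)) * real (card (falsifying_level V E C 3))
           \<le> 6 * real (card (falsifying_level V E C 5))"
proof -
  let ?n = "real (card V)" and ?H = "E - lit_var ` C"
  let ?\<S> = "(\<lambda>x. V - odd_verts x) ` falsifying E C"
  have fin: "finite V" "finite E"
    using G simple_graph_finite_edges by (auto simp: simple_graph_def)
  have EH: "E - ?H = lit_var ` C" using C by auto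
  obtain K where K: "K \<subseteq> V" "real (card K) \<ge> ?n - ?n / 10"
    "\<And>u v. u \<in> K \<Longrightarrow> v \<in> K \<Longrightarrow> u \<noteq> v \<Longrightarrow> \<exists>y\<subseteq>?H. odd_verts y = {u, v}"
  proof (rule expander_giant_component[OF G, of ?H "?n / 10"])
    show "real (card (E - ?H)) \<le> c * (?n / 10)" using C(2) by (simp add: EH)
  qed (use n in auto)
  have "(card K - 1) * (card K - 2) * card {S \<in> ?\<S>. card S = 3} \<le> 6 * card {S \<in> ?\<S>. card S = 5}"
  proof (rule pair_exchange[OF fin(1) K(1)])
    fix S u v assume S: "S \<in> ?\<S>" and uv: "u \<in> K" "v \<in> K" "u \<noteq> v"
    obtain x where x: "x \<in> falsifying E C" "S = V - odd_verts x" using S by blast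
    obtain y where y: "y \<subseteq> ?H" "odd_verts y = {u, v}" using K(3)[OF uv] by blast
    have "x \<subseteq> E" "y \<subseteq> E" using x(1) y(1) by (auto simp: falsifying_def)
    then have "finite x" "finite y" using finite_subset[OF _ fin(2)] by blast+
    then have "V - odd_verts (sym_diff x y) = V - sym_diff (odd_verts x) {u, v}"
      by (simp add: odd_verts_sym_diff y(2))
    also have "\<dots> = sym_diff S {u, v}"
    proof -
      have "{u, v} \<subseteq> V" using uv K(1) by blast
      then show ?thesis unfolding x(2) by blast
    qed
    finally have "sym_diff S {u, v} = V - odd_verts (sym_diff x y)" by (rule sym)
    then show "sym_diff S {u, v} \<in> ?\<S>"
    proof (rule image_eqI[where f = "\<lambda>x. V - odd_verts x"])
      show "sym_diff x y \<in> falsifying E C" by (rule falsifying_shift[OF x(1) y(1)])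
    qed
  next
    fix S assume "S \<in> ?\<S>"
    then show "card S \<noteq> 1" using no1 by (auto simp: falsifying_level_def)
  qed auto
  then have "(card K - 1) * (card K - 2) * card (falsifying_level V E C 3)
               \<le> 6 * card (falsifying_level V E C 5)"
    unfolding card_falsifying_level[OF G(1)] mult.assoc[symmetric] by (rule mult_le_mono1)
  then have "real ((card K - 1) * (card K - 2) * card (falsifying_level V E C 3))
               \<le> real (6 * card (falsifying_level V E C 5))"
    by (simp only: of_nat_le_iff)
  moreover have "card K \<ge> 2" using K(2) n by linarith
  ultimately have le: "(real (card K) - 1) * (real (card K) - 2) * real (card (falsifying_level V E C 3))
               \<le> 6 * real (card (falsifying_level V E C 5))"
    by (simp add: of_nat_diff)
  \<comment> \<open>\<open>4 / 5\<close> is a convenient value below \<open>(9 / 10)^2\<close>. The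
    factor \<open>(?n - 3) * (?n - 4)\<close> is chosen to match the ratio of the full levels 5 and
    3 in \<open>falsifying_level_full\<close>.\<close>
  have "4 / 5 * ((?n - 3) * (?n - 4)) \<le> (9 / 10 * ?n - 1) * (9 / 10 * ?n - 2)"
  proof -
    have "(9 / 10 * ?n - 1) * (9 / 10 * ?n - 2) - 4 / 5 * ((?n - 3) * (?n - 4))
            = ?n * ?n / 100 + 29 / 10 * ?n - 38 / 5"
      by (simp add: field_simps)
    moreover have "?n * ?n \<ge> 0" by simp
    ultimately show ?thesis using n by linarith
  qed
  also have "\<dots> \<le> (real (card K) - 1) * (real (card K) - 2)"
    using K(2) n by (intro mult_mono) auto
  finally show ?thesis
    using le by (rule order_trans[OF mult_right_mono[OF _ of_nat_0_le_iff]])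
qed

lemma falsifying_level_wide:
  assumes "finite E" "lit_var ` C \<subseteq> E" "real (card (lit_var ` C)) > w"
  shows "real (card (falsifying_level V E C j)) \<le> 2 powr (real (card E) - w)"
proof -
  have "card (falsifying_level V E C j) \<le> card (falsifying E C)"
    using finite_falsifying[OF assms(1)] by (intro card_mono) (auto simp: falsifying_level_def)
  also have "\<dots> \<le> 2 ^ card (E - lit_var ` C)" by (rule card_falsifying_le[OF assms(1)])
  finally have "real (card (falsifying_level V E C j)) \<le> real (2 ^ card (E - lit_var ` C))"
    by (simp only: of_nat_le_iff)
  also have "\<dots> = 2 powr real (card (E - lit_var ` C))" by (simp add: powr_realpow)
  also have "real (card (E - lit_var ` C)) = real (card E) - real (card (lit_var ` C))"
    using assms by (simp add: card_Diff_subset finite_subset card_mono of_nat_diff)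
  also have "2 powr (real (card E) - real (card (lit_var ` C))) \<le> 2 powr (real (card E) - w)"
    using assms by (intro powr_mono) auto
  finally show ?thesis by simp
qed

text \<open>Since \<open>card V\<close> is odd and the graph is connected, every 3-subset of
  \<open>V\<close> is the violated set of some assignment; for level 5 the upper bound by all
  5-subsets suffices. The second claim bounds the fibre size from below: at most
  \<open>2 ^ card V\<close> fibres of equal size cover all \<open>2 ^ card E\<close>
  assignments.\<close>

lemma falsifying_level_full:
  assumes G: "simple_graph V E" "expander c V E" "c > 0" and n: "odd (card V)" "card V \<ge> 5"
  shows "20 * card (falsifying_level V E {} 5)
           \<le> (card V - 3) * (card V - 4) * card (falsifying_level V E {} 3)"
    and "(card V choose 3) * 2 ^ card E \<le> card (falsifying_level V E {} 3) * 2 ^ card V"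
proof -
  let ?\<S> = "(\<lambda>x. V - odd_verts x) ` Pow E"
  define z where "z = card {y. y \<subseteq> E \<and> odd_verts y = {}}"
  have fin: "finite V" "finite E"
    using G simple_graph_finite_edges by (auto simp: simple_graph_def)
  have level: "card (falsifying_level V E {} j) = card {S \<in> ?\<S>. card S = j} * z" for j
    using card_falsifying_level[OF G(1), of "{}" j] by (simp add: falsifying_empty z_def)
  obtain K where K: "K \<subseteq> V" "real (card K) \<ge> real (card V) - 0"
    "\<And>u v. u \<in> K \<Longrightarrow> v \<in> K \<Longrightarrow> u \<noteq> v \<Longrightarrow> \<exists>y\<subseteq>E. odd_verts y = {u, v}"
  \<comment> \<open>With no edge deleted, \<open>q = 0\<close> is allowed and the component is all
    of \<open>V\<close>.\<close>
  proof (rule expander_giant_component[OF G, of E 0])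
  qed (use n in auto)
  have "K = V" using K(1,2) fin(1) by (intro card_seteq) auto
  have "S \<in> ?\<S>" if S: "S \<subseteq> V" "card S = 3" for S
  proof -
    have "card (V - S) = card V - 3"
      using S fin by (simp add: card_Diff_subset finite_subset)
    then have ev: "even (card (V - S))" using n by simp
    have "\<exists>y\<subseteq>E. odd_verts y = V - S"
    proof (rule odd_verts_surj[OF fin(2) _ _ _ ev])
      show "\<exists>y\<subseteq>E. odd_verts y = {u, v}" if "u \<in> V" "v \<in> V" "u \<noteq> v" for u v
        using K(3)[of u v] that unfolding \<open>K = V\<close> by simp
    qed (use fin(1) in auto)
    then obtain y where y: "y \<subseteq> E" "odd_verts y = V - S" by blast
    then have "V - odd_verts y = S" using S(1) by (simp add: double_diff)
    then show ?thesis using y(1) by blast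
  qed
  then have "{S \<in> ?\<S>. card S = 3} = {S. S \<subseteq> V \<and> card S = 3}" by blast
  then have S3: "card (falsifying_level V E {} 3) = (card V choose 3) * z"
    using n_subsets[OF fin(1), of 3] by (simp add: level)
  have "card {S \<in> ?\<S>. card S = 5} \<le> card {S. S \<subseteq> V \<and> card S = 5}"
    using fin by (intro card_mono) auto
  then have S5: "card (falsifying_level V E {} 5) \<le> (card V choose 5) * z"
    using n_subsets[OF fin(1), of 5] by (simp add: level)
  \<comment> \<open>Used for \<open>k = 4\<close> and \<open>k = 3\<close>, this turns
    \<open>20 * (card V choose 5)\<close> into
    \<open>(card V - 4) * (card V - 3) * (card V choose 3)\<close>.\<close>
  have step: "Suc k * (card V choose Suc k) = (card V - k) * (card V choose k)" for k
    unfolding binomial_absorb_comp binomial_absorption ..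
  have "20 * card (falsifying_level V E {} 5) \<le> 20 * ((card V choose 5) * z)"
    using S5 by simp
  also have "\<dots> = (20 * (card V choose 5)) * z" by simp
  also have "20 * (card V choose 5) = (card V - 4) * (4 * (card V choose 4))"
    using step[of 4] by simp
  also have "4 * (card V choose 4) = (card V - 3) * (card V choose 3)"
    using step[of 3] by simp
  finally show "20 * card (falsifying_level V E {} 5)
           \<le> (card V - 3) * (card V - 4) * card (falsifying_level V E {} 3)"
    unfolding S3 by (simp only: ac_simps)
  have "2 ^ card E = card (\<Union>S\<in>?\<S>. {x \<in> Pow E. V - odd_verts x = S})"
  proof -
    have "(\<Union>S\<in>?\<S>. {x \<in> Pow E. V - odd_verts x = S}) = Pow E" by blast
    then show ?thesis using fin by (simp add: card_Pow)
  qed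
  also have "\<dots> \<le> (\<Sum>S\<in>?\<S>. card {x \<in> Pow E. V - odd_verts x = S})"
    using fin by (intro card_UN_le) auto
  also have "\<dots> = (\<Sum>S\<in>?\<S>. z)"
    using card_falsifying_fibre[OF G(1), of _ "{}"]
    by (intro sum.cong) (simp_all only: falsifying_empty z_def image_empty Diff_empty)
  also have "\<dots> = card ?\<S> * z" by simp
  also have "\<dots> \<le> 2 ^ card V * z"
  proof (rule mult_le_mono1)
    have "card ?\<S> \<le> card (Pow V)" using fin by (intro card_mono) auto
    then show "card ?\<S> \<le> 2 ^ card V" using fin by (simp add: card_Pow)
  qed
  finally show "(card V choose 3) * 2 ^ card E \<le> card (falsifying_level V E {} 3) * 2 ^ card V"
    using S3 by (simp add: mult.assoc mult.commute[of z])
qed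

section \<open>The lower bound\<close>

text \<open>Summing one inequality per clause compares levels 3 and 5, which the refutation covers 2
  and 4 times. The surplus at level 3 must come from wide clauses, each contributing at most
  \<open>B\<close>.\<close>

lemma subcubesums_size_ge:
  fixes c :: real
  assumes G: "simple_graph V E" "expander c V E" "c > 0" and n: "odd (card V)" "card V \<ge> 5"
    and ref: "subcubesums_refutation E (tseitin V E (\<lambda>_. 1)) \<C>"
  shows "real (size \<C>) \<ge> 2 powr ((c / 10 - 1) * real (card V))"
proof -
  let ?n = "real (card V)" and ?m = "real (card E)"
  define M where "M = (?n - 3) * (?n - 4)"
  define B where "B = 2 powr (?m - c * ?n / 10)"
  define N where "N C j = real (card (falsifying_level V E C j))" for C j
  have fin: "finite E" using G(1) by (rule simple_graph_finite_edges)
  have M: "M > 0" unfolding M_def using n by (intro mult_pos_pos) auto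
  have B: "B > 0" by (simp add: B_def)
  have sum: "(\<Sum>C\<in>#\<C>. N C j) = real (j - 1) * N {} j" for j
  proof -
    have "(\<Sum>C\<in>#\<C>. N C j) = real (\<Sum>C\<in>#\<C>. card (falsifying_level V E C j))"
      unfolding N_def by (induction \<C>) simp_all
    then show ?thesis by (simp add: sum_card_falsifying_level[OF G(1) ref] N_def)
  qed
  \<comment> \<open>A single form for both kinds of clause, ready for summation: narrow clauses
    satisfy it without the \<open>B\<close> term, wide ones without the level-5 term.\<close>
  have clause: "4 / 5 * M * N C 3 \<le> 6 * N C 5 + 4 / 5 * M * B" if "C \<in># \<C>" for C
  proof -
    have C: "lit_var ` C \<subseteq> E" using ref that by (auto simp: subcubesums_refutation_def)
    \<comment> \<open>At \<open>j = 1\<close> the covering number is zero, so no clause of the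
      refutation is falsified by an assignment with a single violated vertex.\<close>
    have "(\<Sum>C\<in>#\<C>. card (falsifying_level V E C 1)) = 0"
      using sum_card_falsifying_level[OF G(1) ref, of 1] by simp
    then have "card (falsifying_level V E C 1) = 0" using that by simp
    then have no1: "falsifying_level V E C 1 = {}"
      using finite_falsifying[OF fin, of C] by (simp add: falsifying_level_def)
    show ?thesis
    proof (cases "real (card (lit_var ` C)) \<le> c * ?n / 10")
      case True
      have "4 / 5 * M * N C 3 \<le> 6 * N C 5"
        using falsifying_level_narrow[OF G n(2) C True no1] by (simp add: M_def N_def)
      moreover have "0 \<le> 4 / 5 * M * B" using M B by simp
      ultimately show ?thesis by linarith
    next
      case False
      then have "N C 3 \<le> B"
        using falsifying_level_wide[OF fin C, of "c * ?n / 10" V 3] by (simp add: N_def B_def)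
      then have "4 / 5 * M * N C 3 \<le> 4 / 5 * M * B" using M by simp
      moreover have "0 \<le> N C 5" by (simp add: N_def)
      ultimately show ?thesis by linarith
    qed
  qed
  have "4 / 5 * M * (\<Sum>C\<in>#\<C>. N C 3) = (\<Sum>C\<in>#\<C>. 4 / 5 * M * N C 3)"
    by (simp add: sum_mset_distrib_left)
  also have "\<dots> \<le> (\<Sum>C\<in>#\<C>. 6 * N C 5 + 4 / 5 * M * B)"
    by (intro sum_mset_mono clause)
  also have "\<dots> = 6 * (\<Sum>C\<in>#\<C>. N C 5) + real (size \<C>) * (4 / 5 * M * B)"
    by (simp add: sum_mset.distrib sum_mset_distrib_left)
  finally have "4 / 5 * M * (2 * N {} 3) \<le> 24 * N {} 5 + real (size \<C>) * (4 / 5 * M * B)"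
    by (simp add: sum)
  moreover have "20 * N {} 5 \<le> M * N {} 3"
  proof -
    have "real (20 * card (falsifying_level V E {} 5))
            \<le> real ((card V - 3) * (card V - 4) * card (falsifying_level V E {} 3))"
      using falsifying_level_full(1)[OF G n] by (simp only: of_nat_le_iff)
    then show ?thesis using n by (simp add: M_def N_def of_nat_diff)
  qed
  \<comment> \<open>The left side has coefficient \<open>8 / 5\<close>, while level 5 accounts for
    at most \<open>24 / 20 = 6 / 5\<close>; the remaining \<open>2 / 5\<close> is charged to the
    \<open>B\<close> terms. Any constant above \<open>3 / 5\<close> in place of \<open>4 / 5\<close>
    would leave a positive remainder.\<close>
  ultimately have "M * N {} 3 \<le> M * (2 * real (size \<C>) * B)" by (simp add: algebra_simps)
  then have le: "N {} 3 \<le> 2 * real (size \<C>) * B" using M by simp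
  \<comment> \<open>Only a factor 2 is kept from the binomial coefficient, to cancel the 2 in
    \<open>le\<close>.\<close>
  have "2 * 2 ^ card E \<le> (card V choose 3) * (2::nat) ^ card E"
  proof (rule mult_le_mono1)
    have "(5 choose 3) \<le> (card V choose 3)" using n(2) by (rule binomial_right_mono)
    then show "2 \<le> (card V choose 3)" by (simp add: eval_nat_numeral)
  qed
  also note falsifying_level_full(2)[OF G n]
  finally have "real (2 * 2 ^ card E) \<le> real (card (falsifying_level V E {} 3) * 2 ^ card V)"
    by (simp only: of_nat_le_iff)
  then have "2 * 2 powr ?m \<le> N {} 3 * 2 powr ?n"
    by (simp add: N_def powr_realpow)
  also have "\<dots> \<le> 2 * real (size \<C>) * B * 2 powr ?n"
    using le by (intro mult_right_mono) auto
  finally have "2 powr ?m \<le> real (size \<C>) * 2 powr (?m - c * ?n / 10 + ?n)"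
    by (simp add: B_def powr_add mult.assoc)
  also have "2 powr (?m - c * ?n / 10 + ?n) = 2 powr ?m / 2 powr ((c / 10 - 1) * ?n)"
    unfolding powr_diff[symmetric] by (simp add: algebra_simps)
  finally show ?thesis by (simp add: field_simps)
qed

theorem theorem4p9:
  fixes c :: real and d :: nat
  assumes "c > 10"
  shows "\<exists>\<epsilon>::real. \<epsilon> > 0 \<and> (\<exists>n\<^sub>0::nat. \<forall>n\<ge>n\<^sub>0. \<forall>(V :: nat set) (E :: nat set set).
           odd n \<and> simple_graph V E \<and> card V = n \<and> regular_graph d V E \<and> expander c V E \<longrightarrow>
             (\<forall>\<C>. subcubesums_refutation E (tseitin V E (\<lambda>_. 1)) \<C> \<longrightarrow>
                real (size \<C>) \<ge> 2 powr (\<epsilon> * real n)))"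
\<comment> \<open>The exponent compares \<open>2 powr (card E - n)\<close>, a lower bound for level
  3, with \<open>2 powr (card E - c * n / 10)\<close>, the most that a wide clause covers; it is
  positive because \<open>c > 10\<close>. The threshold 5 is the size required by
  \<open>subcubesums_size_ge\<close>.\<close>
proof (intro exI[of _ "c / 10 - 1"] exI[of _ 5] conjI allI impI; (elim conjE)?)
  show "c / 10 - 1 > 0" using assms by simp
next
  fix n and V :: "nat set" and E :: "nat set set" and \<C>
  assume "5 \<le> n" "odd n" "simple_graph V E" "card V = n" "expander c V E"
    "subcubesums_refutation E (tseitin V E (\<lambda>_. 1)) \<C>"
  then show "real (size \<C>) \<ge> 2 powr ((c / 10 - 1) * real n)"
    using subcubesums_size_ge[of V E c \<C>] assms by simp
qed

end
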